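(* Let $G$ be a normal generalized group in which $e(a)b^{-1}=b^{-1}e(a)$ for all $a,b\in G$. Then $(ab)^{-1}=b^{-1}a^{-1}$ for all $a,b\in G$.
   Context: A generalized group is a non-empty set $G$ with a binary operation (written multiplicatively) such that: (i) $(xy)z=x(yz)$ for all $x,y,z\in G$; (ii) for each $x\in G$ there exists a unique element $e(x)\in G$ such that $xe(x)=e(x)x=x$; (iii) for each $x\in G$ there exists $x^{-1}\in G$ such that $xx^{-1}=x^{-1}x=e(x)$. In a generalized group, the element $x^{-1}$ in (iii) is unique for each $x$. A generalized group $G$ is called normal if $e(xy)=e(x)e(y)$ for all $x,y\in G$. *)

theory Defs
  imports Main
begin

(* Both descriptions are meaningful for x in G when (G, f) is a generalized group: uniqueness of
   the identity e(x) is an axiom, uniqueness of the inverse is lemma ex1_inv below. *)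
definition gg_id :: "'a set \<Rightarrow> ('a \<Rightarrow> 'a \<Rightarrow> 'a) \<Rightarrow> 'a \<Rightarrow> 'a" where
  "gg_id G f x = (THE u. u \<in> G \<and> f x u = x \<and> f u x = x)"

definition gg_inv :: "'a set \<Rightarrow> ('a \<Rightarrow> 'a \<Rightarrow> 'a) \<Rightarrow> 'a \<Rightarrow> 'a" where
  "gg_inv G f x = (THE y. y \<in> G \<and> f x y = gg_id G f x \<and> f y x = gg_id G f x)"

locale generalized_group =
  fixes G :: "'a set" and mult :: "'a \<Rightarrow> 'a \<Rightarrow> 'a" (infixl "\<cdot>" 70)
  assumes nonempty: "G \<noteq> {}"
    and closed: "\<lbrakk>x \<in> G; y \<in> G\<rbrakk> \<Longrightarrow> x \<cdot> y \<in> G"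
    and assoc: "\<lbrakk>x \<in> G; y \<in> G; z \<in> G\<rbrakk> \<Longrightarrow> (x \<cdot> y) \<cdot> z = x \<cdot> (y \<cdot> z)"
    and ex1_id: "x \<in> G \<Longrightarrow> \<exists>!u. u \<in> G \<and> x \<cdot> u = x \<and> u \<cdot> x = x"
    and ex_inv: "x \<in> G \<Longrightarrow> \<exists>y\<in>G. x \<cdot> y = gg_id G (\<cdot>) x \<and> y \<cdot> x = gg_id G (\<cdot>) x"
begin

abbreviation e :: "'a \<Rightarrow> 'a" where "e \<equiv> gg_id G (\<cdot>)"
abbreviation inv :: "'a \<Rightarrow> 'a" where "inv \<equiv> gg_inv G (\<cdot>)"

lemma e_props:
  assumes "x \<in> G"
  shows "e x \<in> G" "x \<cdot> e x = x" "e x \<cdot> x = x"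
  using theI'[OF ex1_id[OF assms]] unfolding gg_id_def by auto

lemma e_unique:
  assumes "x \<in> G" "u \<in> G" "x \<cdot> u = x" "u \<cdot> x = x"
  shows "u = e x"
  using ex1_id[OF assms(1)] e_props[OF assms(1)] assms by blast

lemma e_idem:
  assumes "x \<in> G"
  shows "e x \<cdot> e x = e x"
  using assms e_props[OF assms] by (intro e_unique) (auto simp: closed assoc, metis assoc)

lemma e_of_inverse:
  assumes "x \<in> G" "y \<in> G" "x \<cdot> y = e x" "y \<cdot> x = e x"
  shows "e y = e x"
proof -
  have "e x \<cdot> e y = e x" "e y \<cdot> e x = e x"
    using assms e_props by (metis assoc)+
  then have "e y = e (e x)"
    using assms e_props by (intro e_unique) auto
  also have "\<dots> = e x"
    using assms e_props e_idem by (metis e_unique)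
  finally show ?thesis .
qed

lemma ex1_inv:
  assumes x: "x \<in> G"
  shows "\<exists>!y. y \<in> G \<and> x \<cdot> y = e x \<and> y \<cdot> x = e x"
proof (rule ex_ex1I)
  show "\<exists>y. y \<in> G \<and> x \<cdot> y = e x \<and> y \<cdot> x = e x"
    using ex_inv[OF x] by blast
next
  fix y z
  assume y: "y \<in> G \<and> x \<cdot> y = e x \<and> y \<cdot> x = e x"
    and z: "z \<in> G \<and> x \<cdot> z = e x \<and> z \<cdot> x = e x"
  have "y = y \<cdot> (x \<cdot> z)"
    using x y z e_of_inverse e_props by metis
  also have "\<dots> = e x \<cdot> z"
    using x y z assoc by metis
  also have "\<dots> = z"
    using x z e_of_inverse e_props by metis
  finally show "y = z" .
qed

lemma inv_props:
  assumes "x \<in> G"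
  shows "inv x \<in> G" "x \<cdot> inv x = e x" "inv x \<cdot> x = e x"
  using theI'[OF ex1_inv[OF assms]] unfolding gg_inv_def by auto

end

locale normal_generalized_group = generalized_group +
  assumes normal: "\<lbrakk>x \<in> G; y \<in> G\<rbrakk> \<Longrightarrow> e (x \<cdot> y) = e x \<cdot> e y"

end

theory Submission
  imports Defs
begin

text \<open>An inverse is determined by its two defining equations (\<open>ex1_inv\<close>), so it
  suffices that \<open>?i b \<cdot> ?i a\<close> satisfies them for \<open>a \<cdot> b\<close>. Each
  product collapses in the middle to an identity, \<open>?e b\<close> or \<open>?e a\<close>. That
  identity need not be neutral for its neighbours, but it commutes with inverses, so it can be moved
  out of the way. What remains is \<open>?e a \<cdot> ?e b\<close>, which normality identifies with
  \<open>?e (a \<cdot> b)\<close>.\<close>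

theorem theorem3p3:
  fixes G :: "'a set" and mult :: "'a \<Rightarrow> 'a \<Rightarrow> 'a" (infixl "\<cdot>" 70)
  assumes "normal_generalized_group G (\<cdot>)"
    and "\<And>a b. \<lbrakk>a \<in> G; b \<in> G\<rbrakk> \<Longrightarrow>
           gg_id G (\<cdot>) a \<cdot> gg_inv G (\<cdot>) b = gg_inv G (\<cdot>) b \<cdot> gg_id G (\<cdot>) a"
  shows "\<forall>a\<in>G. \<forall>b\<in>G. gg_inv G (\<cdot>) (a \<cdot> b) = gg_inv G (\<cdot>) b \<cdot> gg_inv G (\<cdot>) a"
proof (intro ballI)
  fix a b assume a: "a \<in> G" and b: "b \<in> G"
  interpret normal_generalized_group G "(\<cdot>)" by (fact assms(1))
  let ?e = "gg_id G (\<cdot>)" and ?i = "gg_inv G (\<cdot>)"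
  note mem = a b inv_props(1)[OF a] inv_props(1)[OF b] e_props(1)[OF a] e_props(1)[OF b]
  have "(a \<cdot> b) \<cdot> (?i b \<cdot> ?i a) = a \<cdot> ((b \<cdot> ?i b) \<cdot> ?i a)"
    using mem by (simp add: assoc closed)
  \<comment> \<open>Moving \<open>?e b\<close> to the right of \<open>?i a\<close> lets
    \<open>a\<close> meet its own inverse.\<close>
  also have "\<dots> = a \<cdot> (?i a \<cdot> ?e b)"
    using a b by (simp add: inv_props assms(2))
  also have "\<dots> = (a \<cdot> ?i a) \<cdot> ?e b"
    using mem by (simp add: assoc)
  also have "\<dots> = ?e (a \<cdot> b)"
    using a b by (simp add: inv_props normal)
  finally have right: "(a \<cdot> b) \<cdot> (?i b \<cdot> ?i a) = ?e (a \<cdot> b)" .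
  have "(?i b \<cdot> ?i a) \<cdot> (a \<cdot> b) = (?i b \<cdot> (?i a \<cdot> a)) \<cdot> b"
    using mem by (simp add: assoc closed)
  \<comment> \<open>Here \<open>?e a\<close> moves to the left of \<open>?i b\<close>, so both
    computations end with the factors in the same order, \<open>?e a \<cdot> ?e b\<close>.\<close>
  also have "\<dots> = (?e a \<cdot> ?i b) \<cdot> b"
    using a b by (simp add: inv_props assms(2))
  also have "\<dots> = ?e a \<cdot> (?i b \<cdot> b)"
    using mem by (simp add: assoc)
  also have "\<dots> = ?e (a \<cdot> b)"
    using a b by (simp add: inv_props normal)
  finally have left: "(?i b \<cdot> ?i a) \<cdot> (a \<cdot> b) = ?e (a \<cdot> b)" .
  have ab: "a \<cdot> b \<in> G"
    using a b by (rule closed)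
  have "?i b \<cdot> ?i a \<in> G"
    using mem by (simp add: closed)
  \<comment> \<open>Both sides are inverses of \<open>a \<cdot> b\<close>, so uniqueness makes them
    equal.\<close>
  then show "?i (a \<cdot> b) = ?i b \<cdot> ?i a"
    using ex1_inv[OF ab] inv_props[OF ab] left right by blast
qed

end
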